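(* Let $F(x,t)=\gamma(x)+t\xi(x)$ be a $k$-th pseudo cylindrical developable surface with associated functions $p,q,\delta$, signed area density $\lambda$ and null vector field $\eta$ as in the context. Suppose $q(x)=\tilde q(x)x^{Q}$ with $\tilde q$ real analytic and $Q\ge k$, and suppose that the striction curve $s$ is regular at $x=0$, i.e. $s'(0)\neq\mathbf 0$. Put $p_0=(0,t(0))$, where $t(x)=-\dfrac{\tilde q(x)}{\|\tilde\xi(x)\|}x^{Q-k}$ is the analytic extension of $-q(x)/\delta(x)$. Then for every integer $n\ge 1$: (1) $\eta\lambda(p_0)\neq 0$ if and only if $k=0$; (2) $\eta\lambda(p_0)=\cdots=\eta^{(n)}\lambda(p_0)=0$ and $\eta^{(n+1)}\lambda(p_0)\neq 0$ if and only if $k=n$.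
   Context: Let $I\subset\mathbb{R}$ be an open interval containing $0$ (all statements are local at $x=0$, so $I$ may be shrunk), and let $\gamma:I\to\mathbb{R}^3$ with $\gamma(0)=0$ and $\xi:I\to S^2$ be real analytic. The ruled surface is $F:I\times\mathbb{R}\to\mathbb{R}^3$, $F(x,t)=\gamma(x)+t\xi(x)$. It is called $k$-th pseudo cylindrical ($k\in\mathbb{Z}_{\ge 0}$) if $\xi'(x)=\tilde\xi(x)x^{k}$ with $\tilde\xi(0)\neq\mathbf 0$; $I$ is taken so small that $\tilde\xi$ has no zeros on $I$. Put $\xi_d=\tilde\xi/\|\tilde\xi\|$, so $\{\xi,\xi_d,\xi\times\xi_d\}$ is an orthonormal frame, and $\delta(x)=\langle\xi'(x),\xi_d(x)\rangle=\|\tilde\xi(x)\|x^{k}$. The functions $p,q,r:I\to\mathbb{R}$ are defined by $\gamma'=p\,\xi+q\,\xi_d+r\,(\xi\times\xi_d)$. $F$ is a developable surface (vanishing Gaussian curvature on the regular part), equivalently $r\equiv 0$. The unit normal vector field is $\nu=\xi\times\xi_d$; the signed area density is $\lambda=\det(F_x,F_t,\nu)=-(q(x)+t\delta(x))$; the null vector field is $\eta=\partial_x-p(x)\partial_t$, which spans $\operatorname{Ker} dF$ at singular points. $\eta^{(n)}\lambda$ denotes $\eta$ applied $n$ times to $\lambda$. The striction curve is $s(x)=F(x,t(x))$ with $t(x)$ as in the claim. *)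

theory Defs
  imports "HOL-Analysis.Analysis"
begin

unbundle cross3_syntax

definition real_analytic_on :: "(real \<Rightarrow> 'a::real_normed_vector) \<Rightarrow> real set \<Rightarrow> bool"
    (infixl "real'_analytic'_on" 50)
  where "f real_analytic_on S \<longleftrightarrow>
    (\<forall>x\<in>S. \<exists>a. \<exists>\<rho>>0. \<forall>y. \<bar>y - x\<bar> < \<rho> \<longrightarrow> (\<lambda>n. (y - x) ^ n *\<^sub>R a n) sums f y)"

definition partial_x :: "(real \<times> real \<Rightarrow> 'a::real_normed_vector) \<Rightarrow> real \<times> real \<Rightarrow> 'a"
  where "partial_x f = (\<lambda>(x, t). vector_derivative (\<lambda>u. f (u, t)) (at x))"

definition partial_t :: "(real \<times> real \<Rightarrow> 'a::real_normed_vector) \<Rightarrow> real \<times> real \<Rightarrow> 'a"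
  where "partial_t f = (\<lambda>(x, t). vector_derivative (\<lambda>v. f (x, v)) (at t))"

text \<open>Gaussian curvature of a parametrised surface, from the coefficients of its first and second
  fundamental forms; it is meaningful only at regular points.\<close>

definition regular_point :: "(real \<times> real \<Rightarrow> real ^ 3) \<Rightarrow> real \<times> real \<Rightarrow> bool"
  where "regular_point f z \<longleftrightarrow> partial_x f z \<times> partial_t f z \<noteq> 0"

definition gaussian_curvature :: "(real \<times> real \<Rightarrow> real ^ 3) \<Rightarrow> real \<times> real \<Rightarrow> real"
  where "gaussian_curvature f z =
    (let fx = partial_x f z; ft = partial_t f z;
         n = (fx \<times> ft) /\<^sub>R norm (fx \<times> ft);
         E = fx \<bullet> fx; F = fx \<bullet> ft; G = ft \<bullet> ft;
         L = partial_x (partial_x f) z \<bullet> n;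
         M = partial_t (partial_x f) z \<bullet> n;
         N = partial_t (partial_t f) z \<bullet> n
     in (L * N - M\<^sup>2) / (E * G - F\<^sup>2))"

definition developable_on :: "(real \<times> real \<Rightarrow> real ^ 3) \<Rightarrow> (real \<times> real) set \<Rightarrow> bool"
  where "developable_on f U \<longleftrightarrow>
    (\<forall>z\<in>U. regular_point f z \<longrightarrow> gaussian_curvature f z = 0)"

definition ruled_surface ::
    "(real \<Rightarrow> real ^ 3) \<Rightarrow> (real \<Rightarrow> real ^ 3) \<Rightarrow> real \<times> real \<Rightarrow> real ^ 3"
  where "ruled_surface \<gamma> \<xi> = (\<lambda>(x, t). \<gamma> x + t *\<^sub>R \<xi> x)"

text \<open>The factor \<open>\<xi>t\<close>, written \<open>\<xi>\<close> with a tilde in the mathematics, must be analytic: for \<open>k > 0\<close>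
  the equation alone does not determine its value at \<open>0\<close>. The interval is small enough for
  \<open>\<xi>t\<close> to have no zeros.\<close>

definition pseudo_cylindrical_on ::
    "real set \<Rightarrow> (real \<Rightarrow> real ^ 3) \<Rightarrow> (real \<Rightarrow> real ^ 3) \<Rightarrow> nat \<Rightarrow> bool"
  where "pseudo_cylindrical_on I \<xi> \<xi>t k \<longleftrightarrow>
    \<xi>t real_analytic_on I \<and> (\<forall>x\<in>I. \<xi>t x \<noteq> 0) \<and>
    (\<forall>x\<in>I. (\<xi> has_vector_derivative x ^ k *\<^sub>R \<xi>t x) (at x))"

definition xi_d :: "(real \<Rightarrow> real ^ 3) \<Rightarrow> real \<Rightarrow> real ^ 3"
  where "xi_d \<xi>t x = \<xi>t x /\<^sub>R norm (\<xi>t x)"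

definition unit_normal :: "(real \<Rightarrow> real ^ 3) \<Rightarrow> (real \<Rightarrow> real ^ 3) \<Rightarrow> real \<Rightarrow> real ^ 3"
  where "unit_normal \<xi> \<xi>t x = \<xi> x \<times> xi_d \<xi>t x"

text \<open>\<open>p\<close>, \<open>q\<close>, \<open>r\<close> are the coordinates of \<open>\<gamma>'\<close> in the
  orthonormal frame \<open>\<xi>\<close>, \<open>\<xi>\<^sub>d\<close>, \<open>\<xi> \<times> \<xi>\<^sub>d\<close>; they are thereby determined on \<open>I\<close>.\<close>

definition frame_coordinates_on ::
    "real set \<Rightarrow> (real \<Rightarrow> real ^ 3) \<Rightarrow> (real \<Rightarrow> real ^ 3) \<Rightarrow> (real \<Rightarrow> real ^ 3) \<Rightarrow>
     (real \<Rightarrow> real) \<Rightarrow> (real \<Rightarrow> real) \<Rightarrow> (real \<Rightarrow> real) \<Rightarrow> bool"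
  where "frame_coordinates_on I \<gamma> \<xi> \<xi>t p q r \<longleftrightarrow>
    (\<forall>x\<in>I. vector_derivative \<gamma> (at x) =
       p x *\<^sub>R \<xi> x + q x *\<^sub>R xi_d \<xi>t x + r x *\<^sub>R (\<xi> x \<times> xi_d \<xi>t x))"

definition signed_area_density ::
    "(real \<Rightarrow> real ^ 3) \<Rightarrow> (real \<Rightarrow> real ^ 3) \<Rightarrow> (real \<Rightarrow> real ^ 3) \<Rightarrow> real \<times> real \<Rightarrow> real"
  where "signed_area_density \<gamma> \<xi> \<xi>t z =
    det (vector [partial_x (ruled_surface \<gamma> \<xi>) z, partial_t (ruled_surface \<gamma> \<xi>) z,
                 unit_normal \<xi> \<xi>t (fst z)] :: real ^ 3 ^ 3)"

text \<open>The null vector field \<open>\<eta> = \<partial>\<^sub>x - p(x) \<partial>\<^sub>t\<close> as a differential operator on functions;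
  its \<open>n\<close>-th power is the iterate \<open>null_field p ^^ n\<close>.\<close>

definition null_field :: "(real \<Rightarrow> real) \<Rightarrow> (real \<times> real \<Rightarrow> real) \<Rightarrow> real \<times> real \<Rightarrow> real"
  where "null_field p g z = partial_x g z - p (fst z) * partial_t g z"

text \<open>The analytic extension of \<open>- q / \<delta>\<close> with \<open>\<delta> x = norm (\<xi>t x) * x ^ k\<close>, where
  \<open>q x = qt x * x ^ Q\<close> and \<open>Q \<ge> k\<close>.\<close>

definition striction_param ::
    "(real \<Rightarrow> real ^ 3) \<Rightarrow> (real \<Rightarrow> real) \<Rightarrow> nat \<Rightarrow> nat \<Rightarrow> real \<Rightarrow> real"
  where "striction_param \<xi>t qt Q k x = - (qt x / norm (\<xi>t x)) * x ^ (Q - k)"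

definition striction_curve ::
    "(real \<Rightarrow> real ^ 3) \<Rightarrow> (real \<Rightarrow> real ^ 3) \<Rightarrow> (real \<Rightarrow> real ^ 3) \<Rightarrow> (real \<Rightarrow> real) \<Rightarrow>
     nat \<Rightarrow> nat \<Rightarrow> real \<Rightarrow> real ^ 3"
  where "striction_curve \<gamma> \<xi> \<xi>t qt Q k x = ruled_surface \<gamma> \<xi> (x, striction_param \<xi>t qt Q k x)"

unbundle no cross3_syntax

end

(* The function u = t - t(x) vanishes at p_0, and eta u = - w with w = p + t', while lambda is
   - ||xi~|| x^k u.  Differentiating along eta, every application removes either a factor x or the
   factor u, so eta^j lambda vanishes at p_0 for j <= k and eta^(k+1) lambda (p_0) is a positive
   multiple of w(0).  Developability gives r = 0, hence s' = w xi, so regularity of s means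
   w(0) is nonzero: the order of vanishing is exactly k. *)

theory Submission
  imports Defs
begin

section \<open>Calculus of finite-order differentiability\<close>

text \<open>Analyticity enters the argument only through the existence of derivatives of every
  order, and this recursive form makes each closure property a short induction, with no manipulation
  of power series for products, inverses or norms. Derivatives are two-sided at the points of
  \<open>S\<close>; the last one need not be continuous.\<close>

primrec n_diff :: "nat \<Rightarrow> (real \<Rightarrow> 'a::real_normed_vector) \<Rightarrow> real set \<Rightarrow> bool"
  where
    "n_diff 0 f S \<longleftrightarrow> True"
  | "n_diff (Suc n) f S \<longleftrightarrow>
      (\<exists>f'. (\<forall>x\<in>S. (f has_vector_derivative f' x) (at x)) \<and> n_diff n f' S)"

lemma n_diff_SucI:
  assumes "\<And>x. x \<in> S \<Longrightarrow> (f has_vector_derivative f' x) (at x)" and "n_diff n f' S"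
  shows "n_diff (Suc n) f S"
  using assms by auto

lemma n_diff_SucE:
  assumes "n_diff (Suc n) f S"
  obtains f' where "\<And>x. x \<in> S \<Longrightarrow> (f has_vector_derivative f' x) (at x)" and "n_diff n f' S"
  using assms by auto

declare n_diff.simps(2) [simp del]

lemma n_diff_Suc_imp: "n_diff (Suc n) f S \<Longrightarrow> n_diff n f S"
proof (induction n arbitrary: f)
  case (Suc n)
  from Suc.prems obtain f' where
    f': "\<And>x. x \<in> S \<Longrightarrow> (f has_vector_derivative f' x) (at x)" "n_diff (Suc n) f' S"
    by (metis n_diff_SucE)
  show ?case by (rule n_diff_SucI[OF f'(1) Suc.IH[OF f'(2)]])
qed simp

text \<open>Openness of \<open>S\<close> makes the derivative at a point of \<open>S\<close> depend
  only on values in \<open>S\<close>; one unfolding is enough, since the same \<open>f'\<close>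
  serves for \<open>g\<close>.\<close>

lemma n_diff_cong:
  assumes "open S" and "n_diff n f S" and "\<And>x. x \<in> S \<Longrightarrow> f x = g x"
  shows "n_diff n g S"
proof (cases n)
  case (Suc m)
  with assms(2) obtain f' where
    "\<And>x. x \<in> S \<Longrightarrow> (f has_vector_derivative f' x) (at x)" "n_diff m f' S"
    by (metis n_diff_SucE)
  then show ?thesis unfolding Suc
    by (intro n_diff_SucI[of S g f'])
      (auto intro: has_vector_derivative_transform_within_open[OF _ assms(1) _ assms(3)])
qed simp

lemma n_diff_const: "n_diff n (\<lambda>x. c) S"
proof (induction n arbitrary: c)
  case (Suc n)
  show ?case by (rule n_diff_SucI[of S _ "\<lambda>x. 0"]) (auto simp: Suc)
qed simp

lemma n_diff_id: "n_diff n (\<lambda>x. x) S"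
proof (cases n)
  case (Suc m)
  show ?thesis unfolding Suc by (rule n_diff_SucI[of S _ "\<lambda>x. 1"]) (auto intro: n_diff_const)
qed simp

lemma n_diff_add: "n_diff n f S \<Longrightarrow> n_diff n g S \<Longrightarrow> n_diff n (\<lambda>x. f x + g x) S"
proof (induction n arbitrary: f g)
  case (Suc n)
  from Suc.prems obtain f' g' where
    f': "\<And>x. x \<in> S \<Longrightarrow> (f has_vector_derivative f' x) (at x)" "n_diff n f' S" and
    g': "\<And>x. x \<in> S \<Longrightarrow> (g has_vector_derivative g' x) (at x)" "n_diff n g' S"
    by (metis n_diff_SucE)
  show ?case
    by (rule n_diff_SucI[of S _ "\<lambda>x. f' x + g' x"])
      (auto intro!: has_vector_derivative_add f' g' Suc.IH)
qed simp

lemma n_diff_sum: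
  "finite A \<Longrightarrow> (\<And>i. i \<in> A \<Longrightarrow> n_diff n (f i) S) \<Longrightarrow> n_diff n (\<lambda>x. \<Sum>i\<in>A. f i x) S"
  by (induction A rule: finite_induct) (auto intro: n_diff_add n_diff_const)

text \<open>The product rule for any bounded bilinear \<open>h\<close>, so that multiplication,
  scaling and inner product are instances. The derivative contains \<open>f\<close> and
  \<open>g\<close> next to \<open>f'\<close> and \<open>g'\<close>, which is why their order is
  first lowered by one and why the induction generalises both.\<close>

lemma n_diff_bilinear:
  assumes h: "bounded_bilinear h"
  shows "n_diff n f S \<Longrightarrow> n_diff n g S \<Longrightarrow> n_diff n (\<lambda>x. h (f x) (g x)) S"
proof (induction n arbitrary: f g)
  case (Suc n)
  from Suc.prems obtain f' g' where
    f': "\<And>x. x \<in> S \<Longrightarrow> (f has_vector_derivative f' x) (at x)" "n_diff n f' S" and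
    g': "\<And>x. x \<in> S \<Longrightarrow> (g has_vector_derivative g' x) (at x)" "n_diff n g' S"
    by (metis n_diff_SucE)
  have "n_diff n f S" "n_diff n g S"
    using Suc.prems by (auto intro: n_diff_Suc_imp)
  then show ?case
    by (intro n_diff_SucI[of S _ "\<lambda>x. h (f x) (g' x) + h (f' x) (g x)"])
      (auto intro!: bounded_bilinear.has_vector_derivative[OF h] f' g' Suc.IH n_diff_add)
qed simp

lemmas n_diff_mult = n_diff_bilinear[OF bounded_bilinear_mult]
lemmas n_diff_scaleR = n_diff_bilinear[OF bounded_bilinear_scaleR]
lemmas n_diff_inner = n_diff_bilinear[OF bounded_bilinear_inner]

lemma n_diff_minus: "n_diff n f S \<Longrightarrow> n_diff n (\<lambda>x. - f x) S"
  using n_diff_scaleR[OF n_diff_const[of n "-1"]] by simp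

lemma n_diff_power:
  fixes f :: "real \<Rightarrow> real"
  shows "n_diff n f S \<Longrightarrow> n_diff n (\<lambda>x. f x ^ m) S"
  by (induction m) (auto intro: n_diff_mult n_diff_const)

text \<open>The derivative \<open>- f' / f^2\<close> involves the inverse of the same
  \<open>f\<close>, which the induction hypothesis provides at the lower order.\<close>

lemma n_diff_inverse:
  fixes f :: "real \<Rightarrow> real"
  shows "n_diff n f S \<Longrightarrow> (\<And>x. x \<in> S \<Longrightarrow> f x \<noteq> 0) \<Longrightarrow> n_diff n (\<lambda>x. inverse (f x)) S"
proof (induction n)
  case (Suc n)
  from Suc.prems obtain f' where
    f': "\<And>x. x \<in> S \<Longrightarrow> (f has_vector_derivative f' x) (at x)" "n_diff n f' S"
    by (metis n_diff_SucE)
  have inv: "n_diff n (\<lambda>x. inverse (f x)) S"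
    using Suc.prems by (intro Suc.IH) (auto intro: n_diff_Suc_imp)
  have "((\<lambda>x. inverse (f x)) has_vector_derivative - (inverse (f x) * f' x * inverse (f x))) (at x)"
    if "x \<in> S" for x
    using DERIV_inverse'[of f "f' x" x UNIV] f'(1)[OF that] Suc.prems(2)[OF that]
    by (simp add: has_real_derivative_iff_has_vector_derivative)
  then show ?case
    by (rule n_diff_SucI) (auto intro!: n_diff_minus n_diff_mult inv f')
qed simp

lemma has_vector_derivative_norm:
  fixes f :: "real \<Rightarrow> 'a::real_inner"
  assumes "(f has_vector_derivative f') (at x)" and "f x \<noteq> 0"
  shows "((\<lambda>x. norm (f x)) has_vector_derivative (f x \<bullet> f') * inverse (norm (f x))) (at x)"
  using has_derivative_compose[OF assms(1)[unfolded has_vector_derivative_def]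
      has_derivative_norm[OF assms(2)]]
  by (simp add: has_vector_derivative_def sgn_div_norm inner_commute ac_simps)

text \<open>Away from zeros the derivative is \<open>(f x \<bullet> f' x) / norm (f x)\<close>; its
  denominator is again the norm of \<open>f\<close>, covered by the induction hypothesis at the
  lower order.\<close>

lemma n_diff_norm:
  fixes f :: "real \<Rightarrow> 'a::real_inner"
  shows "n_diff n f S \<Longrightarrow> (\<And>x. x \<in> S \<Longrightarrow> f x \<noteq> 0) \<Longrightarrow> n_diff n (\<lambda>x. norm (f x)) S"
proof (induction n)
  case (Suc n)
  from Suc.prems obtain f' where
    f': "\<And>x. x \<in> S \<Longrightarrow> (f has_vector_derivative f' x) (at x)" "n_diff n f' S"
    by (metis n_diff_SucE)
  have f: "n_diff n f S"
    using Suc.prems by (auto intro: n_diff_Suc_imp)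
  show ?case
    using Suc.prems(2)
    by (intro n_diff_SucI[of S _ "\<lambda>x. (f x \<bullet> f' x) * inverse (norm (f x))"]
        has_vector_derivative_norm n_diff_mult n_diff_inner n_diff_inverse Suc.IH f f') auto
qed simp

section \<open>From power series to derivatives of every order\<close>

text \<open>Each local expansion is differentiated termwise within its own radius. Taking
  \<open>deriv f\<close> as the derivative gives one function independent of the centre of
  expansion.\<close>

lemma real_analytic_has_derivative:
  fixes f :: "real \<Rightarrow> real"
  assumes "f real_analytic_on S"
  obtains f' where "f' real_analytic_on S" and "\<And>x. x \<in> S \<Longrightarrow> (f has_vector_derivative f' x) (at x)"
proof
  have *: "\<exists>a. \<exists>\<rho>>0. \<forall>y. \<bar>y - x\<bar> < \<rho> \<longrightarrow>
      (f has_real_derivative deriv f y) (at y) \<and> (\<lambda>n. (y - x) ^ n *\<^sub>R a n) sums deriv f y"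
    if "x \<in> S" for x
  proof -
    from assms that obtain a \<rho> where \<rho>: "\<rho> > 0" and
      a: "\<And>y. \<bar>y - x\<bar> < \<rho> \<Longrightarrow> (\<lambda>n. (y - x) ^ n *\<^sub>R a n) sums f y"
      unfolding real_analytic_on_def by blast
    have sums: "(\<lambda>n. a n * z ^ n) sums f (x + z)" if "norm z < \<rho>" for z
      using a[of "x + z"] that by (simp add: mult.commute)
    show ?thesis
    proof (intro exI[of _ "diffs a"] exI[of _ \<rho>] conjI allI impI \<rho>)
      fix y assume y: "\<bar>y - x\<bar> < \<rho>"
      have "((\<lambda>z. \<Sum>n. a n * z ^ n) has_real_derivative (\<Sum>n. diffs a n * (y - x) ^ n)) (at (y - x))"
        by (rule termdiffs_strong'[of \<rho>]) (use y in \<open>auto intro: sums_summable[OF sums]\<close>)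
      then have "((\<lambda>z. f (x + z)) has_real_derivative (\<Sum>n. diffs a n * (y - x) ^ n)) (at (y - x))"
        by (rule has_field_derivative_transform_within_open[of _ _ _ "ball 0 \<rho>"])
          (use y sums_unique[OF sums] in auto)
      then have D: "(f has_real_derivative (\<Sum>n. diffs a n * (y - x) ^ n)) (at y)"
        using DERIV_shift[of f _ "y - x" x] by (simp add: add.commute)
      then show D': "(f has_real_derivative deriv f y) (at y)"
        by (simp add: DERIV_imp_deriv)
      have "((\<lambda>z. f (x + z)) has_real_derivative deriv f y) (at (y - x))"
        using DERIV_shift[of f _ "y - x" x] D' by (simp add: add.commute)
      \<comment> \<open>With the derivative already identified, the differentiated series converges
        to it at the same point, which is the expansion of \<open>deriv f\<close> about
        \<open>x\<close>.\<close>
      from termdiffs_sums_strong[OF sums this] y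
      show "(\<lambda>n. (y - x) ^ n *\<^sub>R diffs a n) sums deriv f y"
        by (simp add: mult.commute)
    qed
  qed
  then show "deriv f real_analytic_on S"
    unfolding real_analytic_on_def by meson
  \<comment> \<open>The case \<open>y = x\<close> of the local statement.\<close>
  show "(f has_vector_derivative deriv f x) (at x)" if "x \<in> S" for x
    using *[OF that] unfolding has_real_derivative_iff_has_vector_derivative
    by (metis abs_zero cancel_comm_monoid_add_class.diff_cancel)
qed

text \<open>Real-valued functions are handled by induction, because the derivative is analytic
  again; vector-valued ones are reassembled from their coordinates in \<open>Basis\<close>.\<close>

lemma real_analytic_imp_n_diff:
  fixes f :: "real \<Rightarrow> 'a::euclidean_space"
  assumes "f real_analytic_on S"
  shows "n_diff n f S"
proof -
  have real: "n_diff n g S" if "g real_analytic_on S" for g :: "real \<Rightarrow> real"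
    using that
  proof (induction n arbitrary: g)
    case (Suc n)
    from real_analytic_has_derivative[OF Suc.prems] show ?case
      by (metis Suc.IH n_diff_SucI)
  qed simp
  have "(\<lambda>x. f x \<bullet> b) real_analytic_on S" for b
    unfolding real_analytic_on_def
  proof
    fix x assume "x \<in> S"
    then obtain a \<rho> where \<rho>: "\<rho> > 0" and
      a: "\<And>y. \<bar>y - x\<bar> < \<rho> \<Longrightarrow> (\<lambda>n. (y - x) ^ n *\<^sub>R a n) sums f y"
      using assms unfolding real_analytic_on_def by blast
    show "\<exists>a. \<exists>\<rho>>0. \<forall>y. \<bar>y - x\<bar> < \<rho> \<longrightarrow> (\<lambda>n. (y - x) ^ n *\<^sub>R a n) sums (f y \<bullet> b)"
      using bounded_linear.sums[OF bounded_linear_inner_left a, of _ b] \<rho>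
      by (intro exI[of _ "\<lambda>n. a n \<bullet> b"] exI[of _ \<rho>]) simp
  qed
  then have "n_diff n (\<lambda>x. \<Sum>b\<in>Basis. (f x \<bullet> b) *\<^sub>R b) S"
    by (intro n_diff_sum n_diff_scaleR n_diff_const real) auto
  then show ?thesis by (simp add: euclidean_representation)
qed

section \<open>Iterates of the null vector field\<close>

lemma null_field_eq:
  assumes "((\<lambda>u. g (u, t)) has_vector_derivative gx) (at x)"
    and "((\<lambda>v. g (x, v)) has_vector_derivative gt) (at t)"
  shows "null_field p g (x, t) = gx - p x * gt"
  using assms by (simp add: null_field_def partial_x_def partial_t_def vector_derivative_at)

text \<open>The sign condition on \<open>c\<close> persists under \<open>\<eta>\<close> because \<open>\<eta>\<close> contributes \<open>- d (p + \<tau>')\<close> to it.\<close>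

lemma null_field_iterates:
  fixes p \<tau> \<tau>' :: "real \<Rightarrow> real"
  assumes S: "open S" "0 \<in> S"
    and \<tau>: "\<And>x. x \<in> S \<Longrightarrow> (\<tau> has_vector_derivative \<tau>' x) (at x)"
    and w: "\<And>n. n_diff n (\<lambda>x. p x + \<tau>' x) S" and w0: "p 0 + \<tau>' 0 \<noteq> 0"
    and g: "\<And>x t. x \<in> S \<Longrightarrow> g (x, t) = x ^ m * d x * (t - \<tau> x) + x ^ Suc m * c x"
    and d: "n_diff (Suc m) d S" "d 0 < 0"
    and c: "n_diff (Suc m) c S" "c 0 * (p 0 + \<tau>' 0) \<ge> 0"
  shows "(\<forall>j\<le>m. (null_field p ^^ j) g (0, \<tau> 0) = 0) \<and>
    (null_field p ^^ Suc m) g (0, \<tau> 0) * (p 0 + \<tau>' 0) > 0"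
  using g d c
proof (induction m arbitrary: g d c)
  case (0 g d c)
  from 0 obtain d' c' where
    d': "\<And>x. x \<in> S \<Longrightarrow> (d has_vector_derivative d' x) (at x)" and
    c': "\<And>x. x \<in> S \<Longrightarrow> (c has_vector_derivative c' x) (at x)"
    by (metis n_diff_SucE)
  let ?e = "\<lambda>x. d x * (\<tau> 0 - \<tau> x) + x * c x"
  \<comment> \<open>At \<open>x = 0\<close> the factors \<open>\<tau> 0 - \<tau> x\<close> and
    \<open>x\<close> vanish, so \<open>d'\<close> and \<open>c'\<close> drop out.\<close>
  have "(?e has_vector_derivative c 0 - d 0 * \<tau>' 0) (at 0)"
    by (rule derivative_eq_intros d' c' \<tau> S refl | simp add: algebra_simps)+
  then have "((\<lambda>x. g (x, \<tau> 0)) has_vector_derivative c 0 - d 0 * \<tau>' 0) (at 0)"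
    by (rule has_vector_derivative_transform_within_open[OF _ S]) (simp add: 0(1))
  moreover have "((\<lambda>t. g (0, t)) has_vector_derivative d 0) (at (\<tau> 0))"
    by (simp add: 0(1) S) (rule derivative_eq_intros refl | simp)+
  ultimately have "null_field p g (0, \<tau> 0) = c 0 - d 0 * (p 0 + \<tau>' 0)"
    by (subst null_field_eq) (auto simp: algebra_simps)
  moreover have "d 0 * (p 0 + \<tau>' 0)\<^sup>2 < 0"
    using 0(3) w0 by (simp add: mult_neg_pos)
  moreover have "(c 0 - d 0 * (p 0 + \<tau>' 0)) * (p 0 + \<tau>' 0) =
      c 0 * (p 0 + \<tau>' 0) - d 0 * (p 0 + \<tau>' 0)\<^sup>2"
    by (simp add: algebra_simps power2_eq_square)
  ultimately have "null_field p g (0, \<tau> 0) * (p 0 + \<tau>' 0) > 0"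
    using 0(5) by simp
  with 0(1)[OF S(2)] show ?case by simp
next
  case (Suc m g d c)
  from Suc.prems obtain d' c' where
    d': "\<And>x. x \<in> S \<Longrightarrow> (d has_vector_derivative d' x) (at x)" "n_diff (Suc m) d' S" and
    c': "\<And>x. x \<in> S \<Longrightarrow> (c has_vector_derivative c' x) (at x)" "n_diff (Suc m) c' S"
    by (metis n_diff_SucE)
  \<comment> \<open>With \<open>u = t - \<tau> x\<close> one has
    \<open>\<eta> u = - (p + \<tau>')\<close>. Differentiating
    \<open>x ^ Suc m * d * u + x ^ Suc (Suc m) * c\<close> and collecting the terms with and without
    \<open>u\<close> gives \<open>x ^ m * D * u + x ^ Suc m * C\<close>. Thus \<open>C\<close> need
    not vanish even when \<open>c\<close> does.\<close>
  define D C where "D = (\<lambda>x. (1 + real m) * d x + x * d' x)"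
    and "C = (\<lambda>x. (2 + real m) * c x + x * c' x + - (d x * (p x + \<tau>' x)))"
  have dc: "n_diff (Suc m) d S" "n_diff (Suc m) c S"
    using Suc.prems by (auto intro: n_diff_Suc_imp)
  have "null_field p g (x, t) = x ^ m * D x * (t - \<tau> x) + x ^ Suc m * C x" if x: "x \<in> S" for x t
  proof -
    note deriv = d'(1)[OF x] c'(1)[OF x] \<tau>[OF x]
    note deriv = deriv[unfolded has_real_derivative_iff_has_vector_derivative[symmetric]]
    have "((\<lambda>x. x ^ Suc m * d x * (t - \<tau> x) + x ^ Suc (Suc m) * c x) has_vector_derivative
        (real (Suc m) * x ^ m * d x + x ^ Suc m * d' x) * (t - \<tau> x) - x ^ Suc m * d x * \<tau>' x +
        real (Suc (Suc m)) * x ^ Suc m * c x + x ^ Suc (Suc m) * c' x) (at x)"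
      unfolding has_real_derivative_iff_has_vector_derivative[symmetric]
      by (rule DERIV_cong[OF DERIV_add[OF DERIV_mult[OF DERIV_mult[OF DERIV_pow deriv(1)]
              DERIV_diff[OF DERIV_const deriv(3)]] DERIV_mult[OF DERIV_pow deriv(2)]]])
        (simp add: algebra_simps)
    then have "((\<lambda>x. g (x, t)) has_vector_derivative
        (real (Suc m) * x ^ m * d x + x ^ Suc m * d' x) * (t - \<tau> x) - x ^ Suc m * d x * \<tau>' x +
        real (Suc (Suc m)) * x ^ Suc m * c x + x ^ Suc (Suc m) * c' x) (at x)"
      by (rule has_vector_derivative_transform_within_open[OF _ S(1) x]) (simp add: Suc.prems(1))
    moreover have "((\<lambda>t. g (x, t)) has_vector_derivative x ^ Suc m * d x) (at t)"
      unfolding Suc.prems(1)[OF x] has_real_derivative_iff_has_vector_derivative[symmetric]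
      by (auto intro!: derivative_eq_intros)
    ultimately show ?thesis
      by (subst null_field_eq) (auto simp: algebra_simps D_def C_def)
  qed
  moreover have nd: "n_diff (Suc m) D S" "n_diff (Suc m) C S"
    unfolding D_def C_def
    by (rule n_diff_add n_diff_add[OF n_diff_add n_diff_minus[OF n_diff_mult[OF dc(1) w]]];
        intro n_diff_mult n_diff_const n_diff_id dc d'(2) c'(2))+
  moreover have "D 0 < 0"
    using Suc.prems(3) by (simp add: D_def mult_pos_neg)
  moreover have "C 0 * (p 0 + \<tau>' 0) \<ge> 0"
  proof -
    have "C 0 * (p 0 + \<tau>' 0) = (2 + real m) * (c 0 * (p 0 + \<tau>' 0)) + - d 0 * (p 0 + \<tau>' 0)\<^sup>2"
      by (simp add: C_def algebra_simps power2_eq_square)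
    moreover have "\<dots> \<ge> 0"
      using Suc.prems(3)
      by (intro add_nonneg_nonneg mult_nonneg_nonneg[OF _ Suc.prems(5)]
          mult_nonneg_nonneg[OF _ zero_le_power2]) auto
    ultimately show ?thesis by simp
  qed
  ultimately have IH: "(\<forall>j\<le>m. (null_field p ^^ j) (null_field p g) (0, \<tau> 0) = 0) \<and>
      (null_field p ^^ Suc m) (null_field p g) (0, \<tau> 0) * (p 0 + \<tau>' 0) > 0"
    by (intro Suc.IH[where d = D and c = C] nd)
  \<comment> \<open>The induction hypothesis concerns \<open>\<eta> g\<close>, so its index is one
    lower; \<open>j = 0\<close> is left, where the positive powers of \<open>x\<close>
    vanish.\<close>
  have "(null_field p ^^ j) g (0, \<tau> 0) = 0" if "j \<le> Suc m" for j
  proof (cases j)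
    case 0
    then show ?thesis by (simp add: Suc.prems(1) S)
  next
    case (Suc i)
    with that IH show ?thesis by (simp add: funpow_Suc_right del: funpow.simps)
  qed
  with IH show ?case by (simp add: funpow_Suc_right del: funpow.simps)
qed

section \<open>Derivative functions and extension by continuity\<close>

lemma n_diff_vector_derivative:
  assumes "open S" and "n_diff (Suc n) f S"
  shows "n_diff n (\<lambda>x. vector_derivative f (at x)) S"
    and "x \<in> S \<Longrightarrow> (f has_vector_derivative vector_derivative f (at x)) (at x)"
proof -
  obtain f' where f': "\<And>x. x \<in> S \<Longrightarrow> (f has_vector_derivative f' x) (at x)" "n_diff n f' S"
    using assms(2) by (metis n_diff_SucE)
  show "n_diff n (\<lambda>x. vector_derivative f (at x)) S"
    using n_diff_cong[OF assms(1) f'(2)] vector_derivative_at[OF f'(1)] by metis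
  show "x \<in> S \<Longrightarrow> (f has_vector_derivative vector_derivative f (at x)) (at x)"
    using f'(1) vector_derivative_at by metis
qed

lemma n_diff_isCont: "n_diff (Suc 0) f S \<Longrightarrow> x \<in> S \<Longrightarrow> isCont f x"
  by (metis n_diff_SucE has_vector_derivative_continuous)

text \<open>Serves to carry identities to \<open>x = 0\<close> that are obtained by cancelling
  \<open>x ^ k\<close>, which is possible only for nonzero \<open>x\<close> when
  \<open>k > 0\<close>.\<close>

lemma isCont_eq_0:
  fixes f :: "real \<Rightarrow> real"
  assumes "isCont f a" and "open S" and "a \<in> S" and "\<And>x. x \<in> S - {a} \<Longrightarrow> f x = 0"
  shows "f a = 0"
proof -
  have "eventually (\<lambda>x. f x = 0) (at a)"
    using assms(2-4) by (auto simp: eventually_at_topological)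
  then have "(f \<longlongrightarrow> 0) (at a)"
    by (rule tendsto_eventually)
  with assms(1) show ?thesis
    by (auto simp: isCont_def intro: LIM_unique)
qed

section \<open>Partial derivatives and curvature of a ruled surface\<close>

lemma partial_t_ruled_surface:
  "partial_t (ruled_surface \<gamma> \<xi>) (x, t) = \<xi> x"
  "partial_t (partial_t (ruled_surface \<gamma> \<xi>)) (x, t) = 0"
proof -
  have *: "partial_t (ruled_surface \<gamma> \<xi>) (x, t) = \<xi> x" for t
    unfolding partial_t_def ruled_surface_def
    by (auto intro!: vector_derivative_at derivative_eq_intros)
  then show "partial_t (ruled_surface \<gamma> \<xi>) (x, t) = \<xi> x" .
  show "partial_t (partial_t (ruled_surface \<gamma> \<xi>)) (x, t) = 0"
    using * by (simp add: partial_t_def[of "partial_t _"])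
qed

lemma partial_x_ruled_surface:
  assumes "(\<gamma> has_vector_derivative \<gamma>') (at x)" and "(\<xi> has_vector_derivative \<xi>') (at x)"
  shows "partial_x (ruled_surface \<gamma> \<xi>) (x, t) = \<gamma>' + t *\<^sub>R \<xi>'"
    and "partial_t (partial_x (ruled_surface \<gamma> \<xi>)) (x, t) = \<xi>'"
proof -
  have *: "partial_x (ruled_surface \<gamma> \<xi>) (x, t) = \<gamma>' + t *\<^sub>R \<xi>'" for t
    unfolding partial_x_def ruled_surface_def
    by (auto intro!: vector_derivative_at derivative_eq_intros assms)
  then show "partial_x (ruled_surface \<gamma> \<xi>) (x, t) = \<gamma>' + t *\<^sub>R \<xi>'" .
  show "partial_t (partial_x (ruled_surface \<gamma> \<xi>)) (x, t) = \<xi>'"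
    unfolding partial_t_def by (auto simp: * intro!: vector_derivative_at derivative_eq_intros)
qed

text \<open>Since \<open>F_tt = 0\<close>, the curvature numerator is \<open>- M^2\<close>, where
  \<open>M\<close> is the component of \<open>\<xi>'\<close> along the normal. At
  \<open>t = 0\<close> that normal is parallel to \<open>\<gamma>' \<times> \<xi>\<close>; if this
  product vanishes, the claim is trivial.\<close>

lemma developable_ruled_surface:
  assumes "developable_on (ruled_surface \<gamma> \<xi>) (I \<times> UNIV)" and "x \<in> I"
    and \<gamma>': "(\<gamma> has_vector_derivative \<gamma>') (at x)" and \<xi>': "(\<xi> has_vector_derivative \<xi>') (at x)"
  shows "\<xi>' \<bullet> cross3 \<gamma>' (\<xi> x) = 0"
proof (cases "cross3 \<gamma>' (\<xi> x) = 0")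
  case False
  note D = partial_x_ruled_surface[OF \<gamma>' \<xi>', of 0, simplified] partial_t_ruled_surface[of \<gamma> \<xi> x 0]
  have "gaussian_curvature (ruled_surface \<gamma> \<xi>) (x, 0) = 0"
    using assms(1,2) False by (auto simp: developable_on_def regular_point_def D)
  \<comment> \<open>Lagrange's identity. As division by zero yields zero, zero curvature forces
    \<open>M = 0\<close> only once the denominator is known to be nonzero.\<close>
  moreover have "(\<gamma>' \<bullet> \<gamma>') * (\<xi> x \<bullet> \<xi> x) - (\<gamma>' \<bullet> \<xi> x)\<^sup>2 \<noteq> 0"
    using False norm_cross[of \<gamma>' "\<xi> x"] by (metis power2_norm_eq_inner norm_eq_zero zero_eq_power2)
  ultimately show ?thesis
    using False by (auto simp: gaussian_curvature_def Let_def D)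
qed simp

section \<open>Order of vanishing of the signed area density\<close>

theorem theorem3p11:
  fixes I :: "real set" and \<gamma> \<xi> \<xi>t :: "real \<Rightarrow> real ^ 3"
    and p q r qt :: "real \<Rightarrow> real" and k Q :: nat
  assumes "open I" and "is_interval I" and "0 \<in> I"
    and "\<gamma> real_analytic_on I" and "\<gamma> 0 = 0"
    and "\<xi> real_analytic_on I" and "\<forall>x\<in>I. norm (\<xi> x) = 1"
    and "pseudo_cylindrical_on I \<xi> \<xi>t k"
    and "frame_coordinates_on I \<gamma> \<xi> \<xi>t p q r"
    and "developable_on (ruled_surface \<gamma> \<xi>) (I \<times> UNIV)"
    and "qt real_analytic_on I" and "\<forall>x\<in>I. q x = qt x * x ^ Q" and "k \<le> Q"
    and "vector_derivative (striction_curve \<gamma> \<xi> \<xi>t qt Q k) (at 0) \<noteq> 0"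
  defines "area_dens \<equiv> signed_area_density \<gamma> \<xi> \<xi>t"
    and "\<eta> \<equiv> null_field p"
    and "p\<^sub>0 \<equiv> (0, striction_param \<xi>t qt Q k 0)"
  shows "(\<eta> area_dens p\<^sub>0 \<noteq> 0 \<longleftrightarrow> k = 0) \<and>
    (\<forall>n\<ge>1. (\<forall>m\<in>{1..n}. (\<eta> ^^ m) area_dens p\<^sub>0 = 0) \<and> (\<eta> ^^ (n + 1)) area_dens p\<^sub>0 \<noteq> 0 \<longleftrightarrow> k = n)"
proof -
  note I = assms(1,3)
  have \<xi>t: "\<xi>t real_analytic_on I" and \<xi>t_nz: "\<And>x. x \<in> I \<Longrightarrow> \<xi>t x \<noteq> 0"
    and \<xi>': "\<And>x. x \<in> I \<Longrightarrow> (\<xi> has_vector_derivative x ^ k *\<^sub>R \<xi>t x) (at x)"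
    using assms(8) by (auto simp: pseudo_cylindrical_on_def)
  note nd = real_analytic_imp_n_diff
  define \<gamma>' where "\<gamma>' = (\<lambda>x. vector_derivative \<gamma> (at x))"
  have \<gamma>': "(\<gamma> has_vector_derivative \<gamma>' x) (at x)" if "x \<in> I" for x
    unfolding \<gamma>'_def using n_diff_vector_derivative(2)[OF I(1) nd[OF assms(4)]] that .
  have nd_\<gamma>': "n_diff n \<gamma>' I" for n
    unfolding \<gamma>'_def by (rule n_diff_vector_derivative(1)[OF I(1) nd[OF assms(4)]])
  have cont: "isCont \<gamma>' 0" "isCont \<xi> 0" "isCont \<xi>t 0"
    using n_diff_isCont I(2) nd_\<gamma>' nd[OF assms(6)] nd[OF \<xi>t] by blast+

  define \<rho> where "\<rho> = (\<lambda>x. norm (\<xi>t x))"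
  have \<rho>: "\<rho> x > 0" if "x \<in> I" for x
    using \<xi>t_nz[OF that] by (simp add: \<rho>_def)
  have nd_\<rho>: "n_diff n \<rho> I" for n
    unfolding \<rho>_def by (rule n_diff_norm[OF nd[OF \<xi>t] \<xi>t_nz])
  define e where "e = xi_d \<xi>t"
  have \<xi>t_e: "\<xi>t x = \<rho> x *\<^sub>R e x" if "x \<in> I" for x
    using \<xi>t_nz[OF that] by (simp add: e_def xi_d_def \<rho>_def)
  have cont_e: "isCont e 0"
    unfolding e_def xi_d_def using cont(3) \<xi>t_nz[OF I(2)] by (intro continuous_intros) auto

  have \<xi>\<xi>: "\<xi> x \<bullet> \<xi> x = 1" if "x \<in> I" for x
    using assms(7) that by (simp add: norm_eq_1)
  have ee: "e x \<bullet> e x = 1" if "x \<in> I" for x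
    using \<xi>t_nz[OF that] by (simp add: e_def xi_d_def dot_square_norm power2_eq_square)
  \<comment> \<open>Differentiating \<open>\<xi> \<bullet> \<xi> = 1\<close> gives
    \<open>2 * x ^ k * \<rho> x * (\<xi> x \<bullet> e x) = 0\<close>.\<close>
  have \<xi>e': "\<xi> x \<bullet> e x = 0" if "x \<in> I - {0}" for x
  proof -
    have x: "x \<in> I" "x \<noteq> 0" using that by auto
    have "((\<lambda>x. \<xi> x \<bullet> \<xi> x) has_vector_derivative
        \<xi> x \<bullet> (x ^ k *\<^sub>R \<xi>t x) + (x ^ k *\<^sub>R \<xi>t x) \<bullet> \<xi> x) (at x)"
      by (rule bounded_bilinear.has_vector_derivative[OF bounded_bilinear_inner \<xi>' \<xi>']) (rule x)+
    moreover have "((\<lambda>x. \<xi> x \<bullet> \<xi> x) has_vector_derivative 0) (at x)"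
      by (rule has_vector_derivative_transform_within_open[OF _ I(1) x(1), of "\<lambda>_. 1"])
        (auto simp: \<xi>\<xi>)
    ultimately have "\<xi> x \<bullet> (x ^ k *\<^sub>R \<xi>t x) + (x ^ k *\<^sub>R \<xi>t x) \<bullet> \<xi> x = 0"
      using vector_derivative_unique_at by blast
    then show ?thesis
      using x \<rho>[of x] by (auto simp: \<xi>t_e inner_commute)
  qed
  have \<xi>e: "\<xi> x \<bullet> e x = 0" if "x \<in> I" for x
  proof (cases "x = 0")
    case True
    have "isCont (\<lambda>x. \<xi> x \<bullet> e x) 0" using cont cont_e by (intro continuous_intros)
    from isCont_eq_0[OF this I \<xi>e'] True show ?thesis by simp
  qed (use \<xi>e' that in auto)
  have cross_\<xi>: "cross3 (\<xi> x) (cross3 (\<xi> x) (e x)) = - e x" if "x \<in> I" for x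
    using \<xi>\<xi> \<xi>e that by (simp add: Lagrange)
  have frame: "\<gamma>' x = p x *\<^sub>R \<xi> x + q x *\<^sub>R e x + r x *\<^sub>R cross3 (\<xi> x) (e x)" if "x \<in> I" for x
    using assms(9) that by (simp add: frame_coordinates_on_def \<gamma>'_def e_def)
  \<comment> \<open>The coordinates come with no regularity of their own; as inner products with the
    frame they inherit it from \<gamma>, \<xi> and \<open>\<xi>t\<close>.\<close>
  have p_eq: "\<gamma>' x \<bullet> \<xi> x = p x" if "x \<in> I" for x
    using \<xi>\<xi>[OF that] \<xi>e[OF that]
    by (simp add: frame[OF that] inner_simps dot_cross_self inner_commute)
  have r_eq: "\<gamma>' x \<bullet> cross3 (\<xi> x) (e x) = r x" if "x \<in> I" for x
    using \<xi>\<xi>[OF that] \<xi>e[OF that] ee[OF that]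
    by (simp add: frame[OF that] inner_simps dot_cross_self dot_cross)
  have nd_p: "n_diff n p I" for n
    using n_diff_cong[OF I(1) n_diff_inner[OF nd_\<gamma>' nd[OF assms(6)]] p_eq] .

  text \<open>Where \<open>\<xi>' = 0\<close> the curvature gives no information, so \<open>r 0 = 0\<close> needs continuity.\<close>
  have r0: "r 0 = 0"
  proof -
    have off: "\<gamma>' x \<bullet> cross3 (\<xi> x) (e x) = 0" if "x \<in> I - {0}" for x
    proof -
      have x: "x \<in> I" "x \<noteq> 0" using that by auto
      have "0 = (x ^ k *\<^sub>R \<xi>t x) \<bullet> cross3 (\<gamma>' x) (\<xi> x)"
        using developable_ruled_surface[OF assms(10) x(1) \<gamma>'[OF x(1)] \<xi>'[OF x(1)]] by simp
      \<comment> \<open>Cyclic invariance of the triple product turns the developability condition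
        into one on the normal component of \<open>\<gamma>'\<close>.\<close>
      also have "\<dots> = x ^ k * \<rho> x * (\<gamma>' x \<bullet> cross3 (\<xi> x) (e x))"
        using cross_triple[of "\<gamma>' x" "\<xi> x" "e x"]
        by (simp add: \<xi>t_e[OF x(1)] inner_commute)
      finally show ?thesis using x \<rho>[of x] by simp
    qed
    have "isCont (\<lambda>x. \<gamma>' x \<bullet> cross3 (\<xi> x) (e x)) 0"
      by (intro continuous_inner continuous_cross cont cont_e)
    from isCont_eq_0[OF this I off] show ?thesis
      by (simp add: r_eq[OF I(2)])
  qed

  define \<tau> where "\<tau> = striction_param \<xi>t qt Q k"
  define \<tau>' where "\<tau>' = (\<lambda>x. vector_derivative \<tau> (at x))"
  have nd_\<tau>: "n_diff n \<tau> I" for n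
    unfolding \<tau>_def striction_param_def[abs_def] divide_inverse \<rho>_def[symmetric]
    by (intro n_diff_mult n_diff_minus n_diff_power n_diff_id n_diff_inverse nd[OF assms(11)])
      (use nd_\<rho> \<xi>t_nz in \<open>auto simp: \<rho>_def\<close>)
  have \<tau>': "(\<tau> has_vector_derivative \<tau>' x) (at x)" if "x \<in> I" for x
    unfolding \<tau>'_def using n_diff_vector_derivative(2)[OF I(1) nd_\<tau>] that .
  \<comment> \<open>Because \<open>k \<le> Q\<close>, the natural subtraction \<open>Q - k\<close>
    is exact; the identity \<open>q = - \<delta> \<tau>\<close> therefore holds at
    \<open>x = 0\<close> too, without dividing by \<open>x ^ k\<close>.\<close>
  have q_eq: "q x = - (x ^ k * \<rho> x * \<tau> x)" if "x \<in> I" for x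
  proof -
    have "x ^ Q = x ^ k * x ^ (Q - k)"
      using \<open>k \<le> Q\<close> by (simp flip: power_add)
    then show ?thesis
      using assms(12) that \<xi>t_nz[OF that] by (simp add: \<tau>_def striction_param_def \<rho>_def)
  qed

  have w0: "p 0 + \<tau>' 0 \<noteq> 0"
  proof
    assume w: "p 0 + \<tau>' 0 = 0"
    have "((\<lambda>x. \<gamma> x + \<tau> x *\<^sub>R \<xi> x) has_vector_derivative
        \<gamma>' 0 + (\<tau> 0 *\<^sub>R (0 ^ k *\<^sub>R \<xi>t 0) + \<tau>' 0 *\<^sub>R \<xi> 0)) (at 0)"
      by (intro has_vector_derivative_add \<gamma>' I
          bounded_bilinear.has_vector_derivative[OF bounded_bilinear_scaleR] \<tau>' \<xi>')
    \<comment> \<open>The \<open>e\<close> components cancel by \<open>q_eq\<close>, and the normal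
      component vanishes by \<open>r0\<close>.\<close>
    moreover have "\<gamma>' 0 + (\<tau> 0 *\<^sub>R (0 ^ k *\<^sub>R \<xi>t 0) + \<tau>' 0 *\<^sub>R \<xi> 0) = (p 0 + \<tau>' 0) *\<^sub>R \<xi> 0"
      by (simp add: frame[OF I(2)] r0 q_eq[OF I(2)] \<xi>t_e[OF I(2)] algebra_simps)
    ultimately have "vector_derivative (striction_curve \<gamma> \<xi> \<xi>t qt Q k) (at 0) = 0"
      using w by (simp add: striction_curve_def[abs_def] ruled_surface_def vector_derivative_at
          flip: \<tau>_def)
    with assms(14) show False ..
  qed

  \<comment> \<open>The zero summand puts the density into the shape required by
    \<open>null_field_iterates\<close>, with \<open>d = - \<rho>\<close>, negative at
    \<open>0\<close>, and \<open>c = 0\<close>.\<close>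
  have area: "area_dens (x, t) = x ^ k * - \<rho> x * (t - \<tau> x) + x ^ Suc k * 0" if "x \<in> I" for x t
  proof -
    have "area_dens (x, t) =
        (\<gamma>' x + t *\<^sub>R (x ^ k *\<^sub>R \<xi>t x)) \<bullet> cross3 (\<xi> x) (cross3 (\<xi> x) (e x))"
      by (simp add: area_dens_def signed_area_density_def partial_t_ruled_surface dot_cross_det
          partial_x_ruled_surface[OF \<gamma>'[OF that] \<xi>'[OF that]] unit_normal_def e_def)
    also have "\<dots> = - (q x + t * x ^ k * \<rho> x)"
      using ee[OF that] \<xi>e[OF that]
      by (simp add: cross_\<xi>[OF that] frame[OF that] \<xi>t_e[OF that] inner_simps dot_cross_self)
    finally show ?thesis by (simp add: q_eq[OF that] algebra_simps)
  qed

  have "(\<forall>j\<le>k. (\<eta> ^^ j) area_dens p\<^sub>0 = 0) \<and>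
      (\<eta> ^^ Suc k) area_dens p\<^sub>0 * (p 0 + \<tau>' 0) > 0"
    unfolding \<eta>_def p\<^sub>0_def \<tau>_def[symmetric]
  proof (rule null_field_iterates[where \<tau>' = \<tau>' and d = "\<lambda>x. - \<rho> x" and c = "\<lambda>x. 0"])
    show "n_diff n (\<lambda>x. p x + \<tau>' x) I" for n
      unfolding \<tau>'_def by (intro n_diff_add nd_p n_diff_vector_derivative(1)[OF I(1) nd_\<tau>])
  qed (use I \<tau>' w0 area \<rho> in \<open>auto intro: n_diff_minus nd_\<rho> n_diff_const\<close>)
  then have zero: "\<And>j. j \<le> k \<Longrightarrow> (\<eta> ^^ j) area_dens p\<^sub>0 = 0"
    and nonzero: "(\<eta> ^^ Suc k) area_dens p\<^sub>0 \<noteq> 0"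
    by auto
  show ?thesis
  proof (intro conjI allI impI)
    show "\<eta> area_dens p\<^sub>0 \<noteq> 0 \<longleftrightarrow> k = 0"
      using zero[of 1] nonzero by (cases k) auto
    fix n :: nat
    show "(\<forall>m\<in>{1..n}. (\<eta> ^^ m) area_dens p\<^sub>0 = 0) \<and> (\<eta> ^^ (n + 1)) area_dens p\<^sub>0 \<noteq> 0 \<longleftrightarrow> k = n"
    proof
      assume *: "(\<forall>m\<in>{1..n}. (\<eta> ^^ m) area_dens p\<^sub>0 = 0) \<and> (\<eta> ^^ (n + 1)) area_dens p\<^sub>0 \<noteq> 0"
      \<comment> \<open>Nonvanishing at index \<open>n + 1\<close> gives \<open>k \<le> n\<close>;
        nonvanishing at \<open>Suc k\<close> puts that index beyond \<open>n\<close>, so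
        \<open>n \<le> k\<close>.\<close>
      then have "\<not> n + 1 \<le> k" using zero by blast
      moreover have "Suc k \<notin> {1..n}" using * nonzero by blast
      ultimately show "k = n" by simp
    qed (use zero nonzero in auto)
  qed
qed

end
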